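(* Let $n\ge 3$. For every $\xi\in\mathcal{C}(\mathcal{G}_n)$, the number $g_\xi^{(n)}$ of unlabelled graphs $G$ of order $n$ (isomorphism classes of graphs of order $n$) with $|\Gamma(G)|=\xi$ satisfies $$g_\xi^{(n)}=\frac{\xi}{n!}\,|\mathcal{L}_\xi(\mathcal{G}_n)|.$$
   Context: Let $V=\{1,\dots,n\}$ and let $\binom{V}{2}$ be the set of 2-element subsets of $V$; write $ij$ for $\{i,j\}$ with $i<j$. A labelled graph of order $n$ is a pair $G=(V,E)$ with $E\subseteq\binom{V}{2}$; $\mathcal{G}_n$ is the set of all of them. Let $A$ be the symmetric group on $V$. For $\alpha\in A$, $\alpha G$ is the graph on $V$ with edge-set $\{\{\alpha i,\alpha j\}: ij\in E\}$; two labelled graphs $G,H$ are isomorphic if $H=\alpha G$ for some $\alpha\in A$, and $\Gamma(G)=\{\alpha\in A:\alpha G=G\}$ is the automorphism group of $G$. Let $\alpha'$ be the permutation of $\binom{V}{2}$ given by $\alpha'\{i,j\}=\{\alpha i,\alpha j\}$, and let $Z(\alpha')$ be the set of all cycles (including cycles of length 1) in the disjoint cycle decomposition of $\alpha'$. Let $\lambda=\binom{n}{2}$, and for $ij\in\binom{V}{2}$ ($i<j$) let $p_{ij}=\frac{(2n-i)(i-1)}{2}+(j-i)$ and $w(ij)=2^{\lambda-p_{ij}}$. For a cycle $z$ let $W(z)=\sum_{ij\in z}w(ij)$, and define the polynomials $$F_\alpha^{(n)}(x)=\prod_{z\in Z(\alpha')}\bigl(1+x^{W(z)}\bigr)\ (\alpha\in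 A),\qquad F^{(n)}(x)=\sum_{\alpha\in A}F_\alpha^{(n)}(x).$$ Let $c_L$ be the coefficient of $x^L$ in $F^{(n)}(x)$. Put $\mathcal{C}(\mathcal{G}_n)=\{c_L : L\ge 0,\ c_L\neq 0\}$, and for a positive integer $\xi$ put $\mathcal{L}_\xi(\mathcal{G}_n)=\{L : c_L=\xi\}$. *)

theory Defs
  imports
    Complex_Main
    "HOL-Library.Ramsey"
    "HOL-Library.Disjoint_Sets"
    "HOL-Combinatorics.Orbits"
    "HOL-Computational_Algebra.Polynomial"
begin

section \<open>Labelled graphs, isomorphism, automorphisms\<close>

type_synonym lgraph = "nat set \<times> nat set set"

abbreviation vertices :: "nat \<Rightarrow> nat set" where
  "vertices n \<equiv> {1..n}"

abbreviation vpairs :: "nat \<Rightarrow> nat set set" where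
  "vpairs n \<equiv> [vertices n]\<^bsup>2\<^esup>"

definition labelled_graphs :: "nat \<Rightarrow> lgraph set" where
  "labelled_graphs n = {(V, E). V = vertices n \<and> E \<subseteq> vpairs n}"

definition graph_image :: "(nat \<Rightarrow> nat) \<Rightarrow> lgraph \<Rightarrow> lgraph" where
  "graph_image \<alpha> G = (fst G, {\<alpha> ` e | e. e \<in> snd G})"

definition graph_iso :: "nat \<Rightarrow> lgraph rel" where
  "graph_iso n = {(G, H). G \<in> labelled_graphs n \<and> H \<in> labelled_graphs n \<and>
     (\<exists>\<alpha>. \<alpha> permutes vertices n \<and> H = graph_image \<alpha> G)}"

definition unlabelled_graphs :: "nat \<Rightarrow> lgraph set set" where
  "unlabelled_graphs n = labelled_graphs n // graph_iso n"

definition automorphisms :: "nat \<Rightarrow> lgraph \<Rightarrow> (nat \<Rightarrow> nat) set" where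
  "automorphisms n G = {\<alpha>. \<alpha> permutes vertices n \<and> graph_image \<alpha> G = G}"

text \<open>
  The existential quantifier over representatives is harmless, because the order of the
  automorphism group is constant on isomorphism classes; see the lemma
  \<open>card_automorphisms_iso\<close> below.
\<close>

definition num_unlabelled :: "nat \<Rightarrow> nat \<Rightarrow> nat" where
  "num_unlabelled n \<xi> =
     card {\<C> \<in> unlabelled_graphs n. \<exists>G\<in>\<C>. card (automorphisms n G) = \<xi>}"


section \<open>The polynomials\<close>

text \<open>
  The induced permutation of the two-element subsets, extended by the identity to all sets
  of natural numbers so that it is a permutation in the sense of \<^term>\<open>(permutes)\<close>.
\<close>

definition pair_perm :: "nat \<Rightarrow> (nat \<Rightarrow> nat) \<Rightarrow> nat set \<Rightarrow> nat set" where
  "pair_perm n \<alpha> = perm_restrict (\<lambda>e. \<alpha> ` e) (vpairs n)"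

text \<open>
  A cycle of the disjoint cycle decomposition is identified with the set of the elements it
  moves around, so that cycles of length 1 are distinguished from each other.
\<close>

definition pair_cycles :: "nat \<Rightarrow> (nat \<Rightarrow> nat) \<Rightarrow> nat set set set" where
  "pair_cycles n \<alpha> = {z. z \<subseteq> vpairs n \<and> cyclic_on (pair_perm n \<alpha>) z}"

text \<open>
  For \<open>1 \<le> i < j \<le> n\<close> the division is exact and no subtraction is truncated, neither
  here nor in the exponent of \<open>pair_weight\<close>; see \<open>pair_index_real\<close> and \<open>pair_index_le\<close>.
\<close>

definition pair_index :: "nat \<Rightarrow> nat \<Rightarrow> nat \<Rightarrow> nat" where
  "pair_index n i j = (2 * n - i) * (i - 1) div 2 + (j - i)"

definition pair_weight :: "nat \<Rightarrow> nat set \<Rightarrow> nat" where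
  "pair_weight n e = 2 ^ ((n choose 2) - pair_index n (Min e) (Max e))"

definition cycle_weight :: "nat \<Rightarrow> nat set set \<Rightarrow> nat" where
  "cycle_weight n z = (\<Sum>e\<in>z. pair_weight n e)"

definition perm_poly :: "nat \<Rightarrow> (nat \<Rightarrow> nat) \<Rightarrow> nat poly" where
  "perm_poly n \<alpha> = (\<Prod>z\<in>pair_cycles n \<alpha>. 1 + monom 1 (cycle_weight n z))"

definition graph_poly :: "nat \<Rightarrow> nat poly" where
  "graph_poly n = (\<Sum>\<alpha> | \<alpha> permutes vertices n. perm_poly n \<alpha>)"

definition coeff_values :: "nat \<Rightarrow> nat set" where
  "coeff_values n = {coeff (graph_poly n) L | L. coeff (graph_poly n) L \<noteq> 0}"

definition coeff_exponents :: "nat \<Rightarrow> nat \<Rightarrow> nat set" where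
  "coeff_exponents n \<xi> = {L. coeff (graph_poly n) L = \<xi>}"


section \<open>Well-definedness\<close>

lemma graph_image_comp: "graph_image \<alpha> (graph_image \<beta> G) = graph_image (\<alpha> \<circ> \<beta>) G"
  unfolding graph_image_def by (auto simp: image_comp)

lemma graph_image_id [simp]: "graph_image id G = G"
  unfolding graph_image_def by simp

lemma permutes_image_vpairs:
  assumes "\<alpha> permutes vertices n" "e \<in> vpairs n"
  shows "\<alpha> ` e \<in> vpairs n"
proof -
  have "inj_on \<alpha> e"
    using permutes_inj[OF assms(1)] by (rule inj_on_subset) simp
  moreover have "\<alpha> ` e \<subseteq> vertices n"
    using assms(2) permutes_image[OF assms(1)] unfolding nsets_def by blast
  ultimately show ?thesis
    using assms(2) by (simp add: nsets_def card_image)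
qed

lemma graph_image_in:
  assumes "\<alpha> permutes vertices n" "G \<in> labelled_graphs n"
  shows "graph_image \<alpha> G \<in> labelled_graphs n"
  using assms(2) permutes_image_vpairs[OF assms(1)]
  unfolding labelled_graphs_def graph_image_def by auto

lemma graph_image_inv:
  assumes "\<alpha> permutes vertices n"
  shows "graph_image (inv \<alpha>) (graph_image \<alpha> G) = G"
  by (simp add: graph_image_comp permutes_inv_o[OF assms])

lemma equiv_graph_iso: "equiv (labelled_graphs n) (graph_iso n)"
proof (rule equivI)
  show "graph_iso n \<subseteq> labelled_graphs n \<times> labelled_graphs n"
    by (auto simp: graph_iso_def)
  show "refl_on (labelled_graphs n) (graph_iso n)"
    unfolding refl_on_def graph_iso_def by (auto intro!: exI[of _ id] permutes_id)
  show "sym (graph_iso n)"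
  proof (rule symI)
    fix G H assume "(G, H) \<in> graph_iso n"
    then obtain \<alpha> where "G \<in> labelled_graphs n" "H \<in> labelled_graphs n"
      and a: "\<alpha> permutes vertices n" and "H = graph_image \<alpha> G"
      unfolding graph_iso_def by blast
    moreover from this have "G = graph_image (inv \<alpha>) H"
      using graph_image_inv[OF a] by simp
    ultimately show "(H, G) \<in> graph_iso n"
      unfolding graph_iso_def using permutes_inv[OF a] by blast
  qed
  show "trans (graph_iso n)"
  proof (rule transI)
    fix G H K assume "(G, H) \<in> graph_iso n" "(H, K) \<in> graph_iso n"
    then obtain \<alpha> \<beta> where "G \<in> labelled_graphs n" "K \<in> labelled_graphs n"
      and a: "\<alpha> permutes vertices n" and b: "\<beta> permutes vertices n"
      and "K = graph_image \<beta> (graph_image \<alpha> G)"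
      unfolding graph_iso_def by blast
    then show "(G, K) \<in> graph_iso n"
      using permutes_compose[OF a b] unfolding graph_iso_def graph_image_comp by blast
  qed
qed

lemma card_automorphisms_iso:
  assumes "(G, H) \<in> graph_iso n"
  shows "card (automorphisms n G) = card (automorphisms n H)"
proof -
  obtain \<alpha> where a: "\<alpha> permutes vertices n" and H: "H = graph_image \<alpha> G"
    using assms unfolding graph_iso_def by auto
  have i: "inv \<alpha> permutes vertices n" using a by (rule permutes_inv)
  have c: "inv \<alpha> \<circ> \<alpha> = id" "\<alpha> \<circ> inv \<alpha> = id" using permutes_inv_o[OF a] by auto
  have G: "graph_image (inv \<alpha>) H = G" unfolding H by (rule graph_image_inv[OF a])
  have "bij_betw (\<lambda>\<beta>. \<alpha> \<circ> \<beta> \<circ> inv \<alpha>) (automorphisms n G) (automorphisms n H)"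
  proof (rule bij_betw_byWitness[where f' = "\<lambda>\<beta>. inv \<alpha> \<circ> \<beta> \<circ> \<alpha>"])
    show "\<forall>\<beta>\<in>automorphisms n G. inv \<alpha> \<circ> (\<alpha> \<circ> \<beta> \<circ> inv \<alpha>) \<circ> \<alpha> = \<beta>"
         "\<forall>\<beta>\<in>automorphisms n H. \<alpha> \<circ> (inv \<alpha> \<circ> \<beta> \<circ> \<alpha>) \<circ> inv \<alpha> = \<beta>"
      using c by (simp_all add: fun_eq_iff)
    show "(\<lambda>\<beta>. \<alpha> \<circ> \<beta> \<circ> inv \<alpha>) ` automorphisms n G \<subseteq> automorphisms n H"
      unfolding automorphisms_def
      by (auto intro!: permutes_compose i a simp: graph_image_comp[symmetric] G H[symmetric] simp del: One_nat_def)
    show "(\<lambda>\<beta>. inv \<alpha> \<circ> \<beta> \<circ> \<alpha>) ` automorphisms n H \<subseteq> automorphisms n G"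
      unfolding automorphisms_def
      by (auto intro!: permutes_compose i a simp: graph_image_comp[symmetric] G H[symmetric] simp del: One_nat_def)
  qed
  then show ?thesis by (rule bij_betw_same_card)
qed

lemma pair_perm_permutes:
  assumes "\<alpha> permutes vertices n"
  shows "pair_perm n \<alpha> permutes vpairs n"
proof (rule bij_imp_permutes)
  have inj: "inj_on (\<lambda>e. \<alpha> ` e) (vpairs n)"
    using permutes_inj[OF assms] by (auto intro!: inj_onI simp: inj_image_eq_iff)
  have "(\<lambda>e. \<alpha> ` e) ` vpairs n = vpairs n"
  proof (rule card_subset_eq)
    show "finite (vpairs n)" by (simp add: finite_imp_finite_nsets)
    show "(\<lambda>e. \<alpha> ` e) ` vpairs n \<subseteq> vpairs n"
      using permutes_image_vpairs[OF assms] by blast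
    show "card ((\<lambda>e. \<alpha> ` e) ` vpairs n) = card (vpairs n)"
      by (rule card_image[OF inj])
  qed
  then have "bij_betw (\<lambda>e. \<alpha> ` e) (vpairs n) (vpairs n)"
    using inj by (simp add: bij_betw_def)
  then show "bij_betw (pair_perm n \<alpha>) (vpairs n) (vpairs n)"
    by (rule bij_betw_cong[THEN iffD1, rotated]) (simp add: pair_perm_def perm_restrict_def)
qed (simp add: pair_perm_def perm_restrict_def)

lemma pair_cycles_partition:
  assumes "\<alpha> permutes vertices n"
  shows "partition_on (vpairs n) (pair_cycles n \<alpha>)"
proof -
  let ?f = "pair_perm n \<alpha>"
  have f: "?f permutes vpairs n" by (rule pair_perm_permutes[OF assms])
  have "permutation ?f"
    using f finite_imp_finite_nsets[of "vertices n" 2] unfolding permutation_permutes by auto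
  note self = permutation_self_in_orbit[OF this]
  have sub: "orbit ?f e \<subseteq> vpairs n" if "e \<in> vpairs n" for e
    using that by (rule permutes_orbit_subset[OF f])
  have eq: "pair_cycles n \<alpha> = orbit ?f ` vpairs n"
  proof (intro set_eqI iffI)
    fix z assume "z \<in> pair_cycles n \<alpha>"
    then show "z \<in> orbit ?f ` vpairs n"
      unfolding pair_cycles_def cyclic_on_def by auto
  next
    fix z assume "z \<in> orbit ?f ` vpairs n"
    then obtain e where "e \<in> vpairs n" "z = orbit ?f e" by auto
    then show "z \<in> pair_cycles n \<alpha>"
      using sub self[of e] unfolding pair_cycles_def cyclic_on_def by auto
  qed
  show ?thesis
  proof (rule partition_onI)
    show "\<Union> (pair_cycles n \<alpha>) = vpairs n"
      using sub self unfolding eq by auto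
    show "disjnt z z'" if "z \<in> pair_cycles n \<alpha>" "z' \<in> pair_cycles n \<alpha>" "z \<noteq> z'" for z z'
    proof (rule ccontr)
      assume "\<not> disjnt z z'"
      then obtain e where "e \<in> z" "e \<in> z'" unfolding disjnt_def by auto
      moreover have "cyclic_on ?f z" "cyclic_on ?f z'"
        using that unfolding pair_cycles_def by auto
      ultimately have "z = orbit ?f e" "z' = orbit ?f e"
        by (auto dest: orbit_cyclic_eq3)
      with that show False by simp
    qed
    show "{} \<notin> pair_cycles n \<alpha>"
      unfolding eq using self by auto
  qed
qed

lemma even_pair_index: "even ((2 * n - i) * (i - 1))" if "1 \<le> i" "i \<le> n" for i n :: nat
  using that by auto

lemma pair_index_real:
  assumes "1 \<le> i" "i < j" "j \<le> n"
  shows "real (pair_index n i j) = (2 * real n - real i) * (real i - 1) / 2 + (real j - real i)"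
proof -
  have "real ((2 * n - i) * (i - 1) div 2) = real ((2 * n - i) * (i - 1)) / 2"
    using even_pair_index[of i n] assms real_of_nat_div[of 2 "(2 * n - i) * (i - 1)"] by simp
  also have "\<dots> = (2 * real n - real i) * (real i - 1) / 2"
    using assms by (simp add: of_nat_diff)
  finally show ?thesis
    using assms by (simp add: pair_index_def of_nat_diff)
qed

lemma pair_index_le:
  assumes "1 \<le> i" "i < j" "j \<le> n"
  shows "pair_index n i j \<le> n choose 2"
proof -
  obtain d where d: "j = i + Suc d" using assms less_iff_Suc_add by auto
  obtain k where k: "n = j + k" using assms le_Suc_ex by auto
  have "real (n choose 2) = real n * (real n - 1) / 2"
    using assms by (subst choose_two, subst real_of_nat_div) (auto simp: of_nat_diff)
  moreover have "real n * (real n - 1) / 2 - real (pair_index n i j)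
      = (real n - real i) * (real n - real i - 1) / 2 + (real n - real j)"
    unfolding pair_index_real[OF assms] by (simp add: field_simps)
  moreover have "\<dots> \<ge> 0"
    unfolding k d by (simp add: algebra_simps)
  ultimately have "real (pair_index n i j) \<le> real (n choose 2)" by linarith
  then show ?thesis by simp
qed

end

theory Submission
  imports Defs "HOL-Library.Nat_Bijection"
begin

text \<open>
  The weights are distinct powers of two, so an edge set is determined by its total weight.
  A product of factors \<open>1 + x^W(z)\<close> over the cycles of \<open>\<alpha>'\<close> expands over the unions of cycles,
  which are exactly the edge sets fixed by \<open>\<alpha>\<close>. Summing over \<open>\<alpha>\<close>, the coefficient at the
  weight of a graph counts its automorphisms, and all other coefficients vanish. Hence
  \<open>|L_\<xi>|\<close> is the number of labelled graphs with \<open>\<xi>\<close> automorphisms, and these fall into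
  isomorphism classes of size \<open>n!/\<xi>\<close> by the orbit-stabiliser theorem.
\<close>

declare One_nat_def [simp del]

section \<open>Edge sets are determined by their weight\<close>

lemma finite_vpairs: "finite (vpairs n)"
  by (simp add: finite_imp_finite_nsets)

text \<open>\<open>pair_index\<close> numbers the pairs lexicographically: row \<open>i\<close> has
  length \<open>m = n - i\<close>, and moving on by \<open>a\<close> rows raises the offset by
  \<open>a * (2 * m + 1 - a) / 2\<close>. This is at least \<open>m\<close>, hence at least
  \<open>j - i\<close>, while \<open>j' - i'\<close> is positive.\<close>

lemma pair_index_less:
  assumes "1 \<le> i" "i < j" "j \<le> n" "i < i'" "i' < j'" "j' \<le> n"
  shows "pair_index n i j < pair_index n i' j'"
proof -
  define a m where "a = real i' - real i" and "m = real n - real i"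
  have a: "1 \<le> a" "a \<le> m" "real i' = real i + a" "real n = real i + m"
    using assms by (auto simp: a_def m_def)
  \<comment> \<open>Expanded, this product is \<open>a * (2 * m + 1 - a) - 2 * m\<close>.\<close>
  have "0 \<le> (a - 1) * (2 * m - a)"
    using a by (intro mult_nonneg_nonneg) auto
  then have "2 * m \<le> a * (2 * m + 1 - a)"
    by (simp add: algebra_simps)
  moreover have "(2 * real n - real i') * (real i' - 1) - (2 * real n - real i) * (real i - 1)
      = a * (2 * m + 1 - a)"
    unfolding a by (simp add: algebra_simps)
  moreover have "1 \<le> real j' - real i'" "real j - real i \<le> m"
    using assms by (auto simp: m_def)
  ultimately have "real (pair_index n i j) < real (pair_index n i' j')"
    using assms by (simp add: pair_index_real)
  then show ?thesis by simp
qed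

lemma vpairsE:
  assumes "e \<in> vpairs n"
  obtains i j where "e = {i, j}" "1 \<le> i" "i < j" "j \<le> n" "Min e = i" "Max e = j"
proof -
  from assms obtain x y where "e = {x, y}" "x \<noteq> y" "x \<in> vertices n" "y \<in> vertices n"
    by (auto simp: nsets_def card_2_iff)
  then show thesis
    using that[of x y] that[of y x] by (cases "x < y") (auto simp: insert_commute)
qed

text \<open>Naming the exponent lets the weight of an edge set be read as a binary number via
  \<open>set_encode\<close>.\<close>

definition pair_exponent :: "nat \<Rightarrow> nat set \<Rightarrow> nat" where
  "pair_exponent n e = (n choose 2) - pair_index n (Min e) (Max e)"

lemma inj_on_pair_exponent: "inj_on (pair_exponent n) (vpairs n)"
proof (rule inj_onI)
  fix e e' assume "e \<in> vpairs n" "e' \<in> vpairs n" and eq: "pair_exponent n e = pair_exponent n e'"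
  then obtain i j i' j' where
    e: "e = {i, j}" "1 \<le> i" "i < j" "j \<le> n" "Min e = i" "Max e = j" and
    e': "e' = {i', j'}" "1 \<le> i'" "i' < j'" "j' \<le> n" "Min e' = i'" "Max e' = j'"
    by (elim vpairsE)
  \<comment> \<open>By \<open>pair_index_le\<close> neither subtraction is truncated, so the indices
    can be cancelled.\<close>
  have p: "pair_index n i j = pair_index n i' j'"
    using eq pair_index_le[OF e(2-4)] pair_index_le[OF e'(2-4)]
    unfolding pair_exponent_def e(5,6) e'(5,6) by linarith
  then have "i = i'"
    using pair_index_less[OF e(2-4) _ e'(3,4)] pair_index_less[OF e'(2-4) _ e(3,4)]
    by (metis less_irrefl linorder_neqE_nat)
  moreover from this p have "j = j'"
    using e(3) e'(3) by (simp add: pair_index_def)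
  ultimately show "e = e'" using e(1) e'(1) by simp
qed

lemma cycle_weight_eq_set_encode:
  assumes "E \<subseteq> vpairs n"
  shows "cycle_weight n E = set_encode (pair_exponent n ` E)"
proof -
  have "set_encode (pair_exponent n ` E) = (\<Sum>e\<in>E. 2 ^ pair_exponent n e)"
    unfolding set_encode_def
    by (subst sum.reindex[OF inj_on_subset[OF inj_on_pair_exponent assms]]) simp
  then show ?thesis
    by (simp add: cycle_weight_def pair_weight_def pair_exponent_def)
qed

text \<open>Uniqueness of binary expansions, with \<open>cycle_weight\<close> applied to arbitrary
  edge sets and not only to cycles.\<close>

lemma inj_on_cycle_weight: "inj_on (cycle_weight n) (Pow (vpairs n))"
proof (rule inj_onI)
  fix D E assume DE: "D \<in> Pow (vpairs n)" "E \<in> Pow (vpairs n)"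
    and eq: "cycle_weight n D = cycle_weight n E"
  have "finite D" "finite E" using DE finite_vpairs by (auto intro: finite_subset)
  then have "pair_exponent n ` D = pair_exponent n ` E"
    using eq DE by (simp add: cycle_weight_eq_set_encode set_encode_eq)
  then show "D = E" using DE inj_on_image_eq_iff[OF inj_on_pair_exponent] by blast
qed

section \<open>Expanding the product over unions of cycles\<close>

lemma prod_monom: "(\<Prod>a\<in>A. monom 1 (f a)) = monom (1::'a::comm_semiring_1) (sum f A)"
  by (induction A rule: infinite_finite_induct) (simp_all add: mult_monom)

lemma prod_monom_plus_one:
  assumes "finite A"
  shows "(\<Prod>a\<in>A. 1 + monom 1 (f a)) = (\<Sum>B\<in>Pow A. monom (1::'a::comm_semiring_1) (sum f B))"
  using prod_add[OF assms, of "\<lambda>a. monom 1 (f a)" "\<lambda>_. 1"] by (simp add: prod_monom add.commute)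

lemma pair_perm_image: "E \<subseteq> vpairs n \<Longrightarrow> pair_perm n \<alpha> ` E = (`) \<alpha> ` E"
  by (intro image_cong) (auto simp: pair_perm_def perm_restrict_def)

text \<open>An edge set is fixed by \<alpha> iff it is a union of orbits of the induced permutation;
  the inverse map collects the cycles contained in it.\<close>

lemma bij_betw_Union_cycles:
  assumes "\<alpha> permutes vertices n"
  shows "bij_betw Union (Pow (pair_cycles n \<alpha>)) {E. E \<subseteq> vpairs n \<and> (`) \<alpha> ` E = E}"
proof -
  let ?f = "pair_perm n \<alpha>" and ?P = "pair_cycles n \<alpha>"
  note part = pair_cycles_partition[OF assms]
  have f_z: "?f ` z = z" if "z \<in> ?P" for z
  proof (rule endo_inj_surj)
    have cyc: "cyclic_on ?f z" using that by (simp add: pair_cycles_def)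
    then show "finite z" by (rule finite_cyclic_on)
    show "?f ` z \<subseteq> z" using cyclic_on_inI[OF cyc] by blast
    show "inj_on ?f z"
      using permutes_inj[OF pair_perm_permutes[OF assms]] by (rule inj_on_subset) simp
  qed
  show ?thesis
  proof (rule bij_betw_byWitness[where f' = "\<lambda>E. {z \<in> ?P. z \<subseteq> E}"])
    show "\<forall>Y\<in>Pow ?P. {z \<in> ?P. z \<subseteq> \<Union> Y} = Y"
    proof (intro ballI subset_antisym subsetI)
      fix Y z assume Y: "Y \<in> Pow ?P" and z: "z \<in> {z \<in> ?P. z \<subseteq> \<Union> Y}"
      \<comment> \<open>Being nonempty, \<open>z\<close> meets some member of \<open>Y\<close>;
        distinct cycles are disjoint, so \<open>z\<close> is that member.\<close>
      then have "z \<noteq> {}" using partition_onD3[OF part] by auto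
      then obtain e z' where "e \<in> z" "e \<in> z'" "z' \<in> Y" using z by blast
      then show "z \<in> Y"
        using Y z partition_onD2[OF part] disjointD[of ?P z z'] by blast
    qed auto
    show "\<forall>E\<in>{E. E \<subseteq> vpairs n \<and> (`) \<alpha> ` E = E}. \<Union> {z \<in> ?P. z \<subseteq> E} = E"
    proof (intro ballI subset_antisym subsetI)
      fix E e assume "E \<in> {E. E \<subseteq> vpairs n \<and> (`) \<alpha> ` E = E}" and e: "e \<in> E"
      then have E: "E \<subseteq> vpairs n" "(`) \<alpha> ` E = E" by auto
      with e obtain z where z: "z \<in> ?P" "e \<in> z" using partition_onD1[OF part] by blast
      then have "z = orbit ?f e" by (auto simp: pair_cycles_def cyclic_on_alldef)
      have E_im: "?f ` E = E" using E pair_perm_image by simp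
      \<comment> \<open>Follow the orbit, whose inductive definition starts at \<open>?f e\<close>
        rather than at \<open>e\<close>.\<close>
      have "x \<in> E" if "x \<in> orbit ?f e" for x
        using that
      proof induction
        case base
        then show ?case using E_im e by blast
      next
        case (step x)
        then show ?case using E_im by blast
      qed
      then have "z \<subseteq> E" using \<open>z = orbit ?f e\<close> by blast
      then show "e \<in> \<Union> {z \<in> ?P. z \<subseteq> E}" using z by blast
    qed blast
    show "Union ` Pow ?P \<subseteq> {E. E \<subseteq> vpairs n \<and> (`) \<alpha> ` E = E}"
    proof clarsimp
      fix Y assume Y: "Y \<subseteq> ?P"
      then have sub: "\<Union> Y \<subseteq> vpairs n" by (auto simp: pair_cycles_def)
      have "(`) ?f ` Y = id ` Y"
        by (rule image_cong) (use Y f_z in auto)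
      then have "?f ` \<Union> Y = \<Union> Y" by (simp add: image_Union)
      then show "\<Union> Y \<subseteq> vpairs n \<and> (`) \<alpha> ` \<Union> Y = \<Union> Y"
        using sub pair_perm_image[OF sub, of \<alpha>] by simp
    qed
  qed blast
qed

lemma perm_poly_eq:
  assumes "\<alpha> permutes vertices n"
  shows "perm_poly n \<alpha> = (\<Sum>E | E \<subseteq> vpairs n \<and> (`) \<alpha> ` E = E. monom 1 (cycle_weight n E))"
proof -
  note part = pair_cycles_partition[OF assms]
  have fin: "finite (pair_cycles n \<alpha>)"
    by (rule finite_elements[OF finite_vpairs part])
  \<comment> \<open>Cycles are disjoint, so weights add up: the exponent arising from a choice of
    cycles is the weight of their union.\<close>
  have "cycle_weight n (\<Union> Y) = sum (cycle_weight n) Y" if "Y \<subseteq> pair_cycles n \<alpha>" for Y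
  proof -
    have "\<forall>z\<in>Y. finite z" using that finite_vpairs
      by (auto simp: pair_cycles_def intro: finite_subset)
    moreover have "\<forall>z\<in>Y. \<forall>z'\<in>Y. z \<noteq> z' \<longrightarrow> z \<inter> z' = {}"
      using partition_onD2[OF part] that by (auto simp: disjoint_def)
    ultimately show ?thesis
      using sum.Union_disjoint[of Y "pair_weight n"] by (simp add: cycle_weight_def[abs_def] comp_def)
  qed
  then show ?thesis
    unfolding perm_poly_def prod_monom_plus_one[OF fin]
      sum.reindex_bij_betw[OF bij_betw_Union_cycles[OF assms], symmetric]
    by (intro sum.cong) auto
qed

section \<open>Coefficients count automorphisms\<close>

lemma finite_labelled_graphs: "finite (labelled_graphs n)"
proof (rule finite_subset)
  show "labelled_graphs n \<subseteq> {vertices n} \<times> Pow (vpairs n)" by (auto simp: labelled_graphs_def)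
qed (intro finite_cartesian_product finite_Pow_iff[THEN iffD2] finite_vpairs finite.intros)

text \<open>Double counting of the pairs of a permutation and an edge set of weight \<open>L\<close>
  that it fixes.\<close>

lemma coeff_graph_poly:
  "coeff (graph_poly n) L =
     (\<Sum>G\<in>labelled_graphs n. if cycle_weight n (snd G) = L then card (automorphisms n G) else 0)"
proof -
  let ?A = "{\<alpha>. \<alpha> permutes vertices n}"
  let ?w = "\<lambda>E. if cycle_weight n E = L then 1 else (0::nat)"
  have finA: "finite ?A" by (simp add: finite_permutations)
  have lg: "labelled_graphs n = Pair (vertices n) ` Pow (vpairs n)"
    by (auto simp: labelled_graphs_def)
  have "coeff (graph_poly n) L = (\<Sum>\<alpha>\<in>?A. \<Sum>E | E \<subseteq> vpairs n \<and> (`) \<alpha> ` E = E. ?w E)"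
    by (simp add: graph_poly_def coeff_sum perm_poly_eq)
  \<comment> \<open>Moving the condition into the summand makes the range of \<open>E\<close>
    independent of \<alpha>, so that the sums can be swapped.\<close>
  also have "\<dots> = (\<Sum>\<alpha>\<in>?A. \<Sum>E\<in>Pow (vpairs n). if (`) \<alpha> ` E = E then ?w E else 0)"
    by (simp add: sum.inter_filter[symmetric] finite_vpairs Pow_def del: Collect_conj_eq)
  also have "\<dots> = (\<Sum>E\<in>Pow (vpairs n). \<Sum>\<alpha>\<in>?A. if (`) \<alpha> ` E = E then ?w E else 0)"
    by (rule sum.swap)
  also have "\<dots> = (\<Sum>E\<in>Pow (vpairs n). ?w E * card (automorphisms n (vertices n, E)))"
  proof (intro sum.cong refl)
    fix E
    have "automorphisms n (vertices n, E) = {\<alpha> \<in> ?A. (`) \<alpha> ` E = E}"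
      by (simp add: automorphisms_def graph_image_def Setcompr_eq_image)
    then show "(\<Sum>\<alpha>\<in>?A. if (`) \<alpha> ` E = E then ?w E else 0)
        = ?w E * card (automorphisms n (vertices n, E))"
      by (simp add: sum.inter_filter[OF finA, symmetric])
  qed
  also have "\<dots> = (\<Sum>G\<in>labelled_graphs n.
      if cycle_weight n (snd G) = L then card (automorphisms n G) else 0)"
    unfolding lg by (subst sum.reindex) (auto simp: inj_on_def intro!: sum.cong)
  finally show ?thesis .
qed

lemma inj_on_graph_weight: "inj_on (\<lambda>G. cycle_weight n (snd G)) (labelled_graphs n)"
  using inj_on_cycle_weight[of n]
  by (auto simp: labelled_graphs_def inj_on_def simp del: Pow_iff)

lemma coeff_graph_poly_weight:
  assumes "G \<in> labelled_graphs n"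
  shows "coeff (graph_poly n) (cycle_weight n (snd G)) = card (automorphisms n G)"
proof -
  have "cycle_weight n (snd H) = cycle_weight n (snd G) \<longleftrightarrow> H = G" if "H \<in> labelled_graphs n" for H
    using inj_on_eq_iff[OF inj_on_graph_weight that assms] .
  then have "coeff (graph_poly n) (cycle_weight n (snd G))
      = (\<Sum>H\<in>labelled_graphs n. if H = G then card (automorphisms n H) else 0)"
    unfolding coeff_graph_poly by (intro sum.cong) auto
  then show ?thesis using assms finite_labelled_graphs by simp
qed

lemma card_coeff_exponents:
  assumes "\<xi> \<noteq> 0"
  shows "card (coeff_exponents n \<xi>) = card {G \<in> labelled_graphs n. card (automorphisms n G) = \<xi>}"
proof -
  have "coeff_exponents n \<xi> = (\<lambda>G. cycle_weight n (snd G)) `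
      {G \<in> labelled_graphs n. card (automorphisms n G) = \<xi>}"
  proof (intro subset_antisym subsetI)
    fix L assume L: "L \<in> coeff_exponents n \<xi>"
    then obtain G where "G \<in> labelled_graphs n" "L = cycle_weight n (snd G)"
    proof -
      \<comment> \<open>A nonzero coefficient has a nonzero summand, and its graph has weight
        \<open>L\<close>.\<close>
      have "coeff (graph_poly n) L \<noteq> 0" using L assms by (simp add: coeff_exponents_def)
      then show thesis
        unfolding coeff_graph_poly
        by (elim sum.not_neutral_contains_not_neutral) (metis that)
    qed
    then show "L \<in> (\<lambda>G. cycle_weight n (snd G)) `
      {G \<in> labelled_graphs n. card (automorphisms n G) = \<xi>}"
      using L coeff_graph_poly_weight[of G n] by (auto simp: coeff_exponents_def)
  qed (auto simp: coeff_exponents_def coeff_graph_poly_weight[symmetric] simp del: split_paired_all split_paired_All)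
  then show ?thesis
    by (simp add: card_image inj_on_subset[OF inj_on_graph_weight])
qed

section \<open>From labelled to unlabelled graphs\<close>

lemma card_transporters:
  assumes "\<beta> permutes vertices n"
  shows "card {\<alpha>. \<alpha> permutes vertices n \<and> graph_image \<alpha> G = graph_image \<beta> G}
    = card (automorphisms n G)"
proof -
  have i: "inv \<beta> permutes vertices n" using assms by (rule permutes_inv)
  have c: "inv \<beta> \<circ> \<beta> = id" "\<beta> \<circ> inv \<beta> = id" using permutes_inv_o[OF assms] by auto
  \<comment> \<open>The permutations taking \<open>G\<close> to its image under \<beta> form the
    left coset of the automorphism group given by \<beta>.\<close>
  have "bij_betw ((\<circ>) \<beta>) (automorphisms n G)
      {\<alpha>. \<alpha> permutes vertices n \<and> graph_image \<alpha> G = graph_image \<beta> G}"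
  proof (rule bij_betw_byWitness[where f' = "(\<circ>) (inv \<beta>)"])
    show "(\<circ>) \<beta> ` automorphisms n G
        \<subseteq> {\<alpha>. \<alpha> permutes vertices n \<and> graph_image \<alpha> G = graph_image \<beta> G}"
      by (auto simp: automorphisms_def graph_image_comp[symmetric] permutes_compose assms)
    show "(\<circ>) (inv \<beta>) ` {\<alpha>. \<alpha> permutes vertices n \<and> graph_image \<alpha> G = graph_image \<beta> G}
        \<subseteq> automorphisms n G"
      by (auto simp: automorphisms_def graph_image_comp[symmetric] permutes_compose i
          graph_image_inv[OF assms])
  qed (simp_all add: o_assoc c)
  from bij_betw_same_card[OF this] show ?thesis by simp
qed

lemma card_isomorphism_class:
  assumes "G \<in> labelled_graphs n"
  shows "card (graph_iso n `` {G}) * card (automorphisms n G) = fact n"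
proof -
  let ?A = "{\<alpha>. \<alpha> permutes vertices n}"
  have cls: "graph_iso n `` {G} = (\<lambda>\<alpha>. graph_image \<alpha> G) ` ?A"
    using assms graph_image_in[OF _ assms] unfolding graph_iso_def by blast
  have fin: "finite ?A" by (simp add: finite_permutations)
  have "fact n = card ?A" by (subst card_permutations[of _ n]) auto
  \<comment> \<open>Sort the permutations by the image of \<open>G\<close>; each fibre is a set of
    transporters.\<close>
  also have "\<dots> = (\<Sum>H\<in>graph_iso n `` {G}. \<Sum>\<alpha> | \<alpha> \<in> ?A \<and> graph_image \<alpha> G = H. 1)"
    unfolding cls by (subst sum.image_gen[OF fin, of _ "\<lambda>\<alpha>. graph_image \<alpha> G", symmetric]) simp
  also have "\<dots> = (\<Sum>H\<in>graph_iso n `` {G}. card (automorphisms n G))"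
    unfolding cls by (intro sum.cong refl) (auto simp: card_transporters)
  finally show ?thesis by simp
qed

lemma card_labelled_graphs_automorphisms:
  "card {G \<in> labelled_graphs n. card (automorphisms n G) = \<xi>} * \<xi> = num_unlabelled n \<xi> * fact n"
proof -
  let ?U = "{\<C> \<in> unlabelled_graphs n. \<exists>G\<in>\<C>. card (automorphisms n G) = \<xi>}"
  note eq = equiv_graph_iso[of n]
  \<comment> \<open>The existential in \<open>num_unlabelled\<close> becomes universal, since
    isomorphic graphs have equally many automorphisms.\<close>
  have all: "card (automorphisms n H) = \<xi>" "H \<in> labelled_graphs n" if "\<C> \<in> ?U" "H \<in> \<C>" for \<C> H
  proof -
    from that obtain G where G: "\<C> \<in> labelled_graphs n // graph_iso n" "G \<in> \<C>"
      and "card (automorphisms n G) = \<xi>"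
      by (auto simp: unlabelled_graphs_def)
    moreover have "(G, H) \<in> graph_iso n"
      using quotient_eqI G that by (meson eq in_quotient_imp_in_rel empty_subsetI insert_subset)
    ultimately show "card (automorphisms n H) = \<xi>" "H \<in> labelled_graphs n"
      using card_automorphisms_iso[of G H n] by (simp_all add: graph_iso_def)
  qed
  have U: "{G \<in> labelled_graphs n. card (automorphisms n G) = \<xi>} = \<Union> ?U"
  proof (intro subset_antisym subsetI)
    fix G assume "G \<in> {G \<in> labelled_graphs n. card (automorphisms n G) = \<xi>}"
    then have "G \<in> graph_iso n `` {G}" "graph_iso n `` {G} \<in> ?U"
      using equiv_class_self[OF eq] unfolding unlabelled_graphs_def by (blast intro: quotientI)+
    then show "G \<in> \<Union> ?U" by blast
  qed (use all in blast)
  \<comment> \<open>Multiplying each class size by \<xi> avoids dividing \<open>fact n\<close> in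
    the naturals.\<close>
  have "card (\<Union> ?U) * \<xi> = (\<Sum>\<C>\<in>?U. card \<C> * \<xi>)"
  proof (subst card_Union_disjoint)
    show "pairwise disjnt ?U"
      using quotient_disj[OF eq] by (auto simp: pairwise_def disjnt_def unlabelled_graphs_def)
    show "finite \<C>" if "\<C> \<in> ?U" for \<C>
      using all(2)[OF that] by (blast intro: finite_subset[OF _ finite_labelled_graphs])
  qed (simp add: sum_distrib_right)
  also have "\<dots> = (\<Sum>\<C>\<in>?U. fact n)"
  proof (intro sum.cong refl)
    fix \<C> assume C: "\<C> \<in> ?U"
    then obtain G where G: "G \<in> labelled_graphs n" "\<C> = graph_iso n `` {G}"
      by (auto simp: unlabelled_graphs_def elim!: quotientE)
    then show "card \<C> * \<xi> = fact n"
      using card_isomorphism_class[of G n] all(1)[OF C, of G] equiv_class_self[OF eq, of G] by auto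
  qed
  finally show ?thesis by (simp add: U num_unlabelled_def)
qed

theorem theorem7:
  fixes n \<xi> :: nat
  assumes "n \<ge> 3" and "\<xi> \<in> coeff_values n"
  shows "real (num_unlabelled n \<xi>) = real \<xi> / fact n * real (card (coeff_exponents n \<xi>))"
proof -
  have "\<xi> \<noteq> 0" using assms(2) by (auto simp: coeff_values_def)
  then have "card (coeff_exponents n \<xi>) * \<xi> = num_unlabelled n \<xi> * fact n"
    using card_labelled_graphs_automorphisms by (simp add: card_coeff_exponents)
  then have "real (card (coeff_exponents n \<xi>)) * real \<xi> = real (num_unlabelled n \<xi>) * fact n"
    by (metis of_nat_fact of_nat_mult)
  then show ?thesis by (simp add: field_simps)
qed

end
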